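(* Let $m,p\ge2$ be integers. Then $$\sum_{n=1}^\infty\frac{\zeta(m)\zeta_n(p)-\zeta(p)\zeta_n(m)}{n}=\zeta(p)\zeta(m,1)-\zeta(m)\zeta(p,1).$$
   Context: $\zeta(s)=\sum_{j\ge1}j^{-s}$, $\zeta_n(s)=\sum_{j=1}^n j^{-s}$, and the multiple zeta value is $\zeta(s_1,\dots,s_k)=\sum_{n_1>n_2>\cdots>n_k\ge1}n_1^{-s_1}\cdots n_k^{-s_k}$ (here $\zeta(m,1)=\sum_{n_1>n_2\ge1}n_1^{-m}n_2^{-1}$). *)

theory Defs
  imports "HOL-Analysis.Infinite_Sum"
begin

definition zeta :: "nat \<Rightarrow> real" where
  "zeta s = (\<Sum>j. 1 / real (Suc j) ^ s)"

definition zeta_partial :: "nat \<Rightarrow> nat \<Rightarrow> real" where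
  "zeta_partial n s = (\<Sum>j=1..n. 1 / real j ^ s)"

(* The multiple zeta value zeta(s_1,...,s_k) for the exponent list ss = [s_1,...,s_k].
   The summation index is the list [n_1,...,n_k] with n_1 > ... > n_k >= 1.  All terms are
   nonnegative, so the unordered sum is the usual one; if it diverges (which cannot happen
   for s_1 >= 2 and s_2,...,s_k >= 1) infsum returns 0. *)
definition mzv :: "nat list \<Rightarrow> real" where
  "mzv ss = (\<Sum>\<^sub>\<infinity>ns\<in>{ns :: nat list. length ns = length ss \<and> sorted_wrt (>) ns \<and> (\<forall>n\<in>set ns. n \<ge> 1)}.
               \<Prod>i<length ss. 1 / real (ns ! i) ^ (ss ! i))"

end

theory Submission
  imports Defs "HOL-Analysis.Elementary_Metric_Spaces"
begin

text \<open>
  The numerator is \<open>\<zeta>(p) (\<zeta>(m) - \<zeta>\<^sub>n(m)) - \<zeta>(m) (\<zeta>(p) - \<zeta>\<^sub>n(p))\<close>, and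
  \<open>\<zeta>(s,1) = \<Sum>\<^sub>n (\<zeta>(s) - \<zeta>\<^sub>n(s)) / n\<close> upon summing the double series for \<open>\<zeta>(s,1)\<close> over its
  larger index first.  The tail bound \<open>\<zeta>(s) - \<zeta>\<^sub>n(s) \<le> 1/n\<close> justifies this interchange.
\<close>

text \<open>With \<open>j = n + k + 2\<close>, the term is at most 1/((j-1) j) = 1/(j-1) - 1/j
  because \<open>s \<ge> 2\<close>, and these differences telescope to 1/(n+1).\<close>

lemma summable_tail:
  assumes "s \<ge> 2"
  shows "summable (\<lambda>k. 1 / real (n + k + 2) ^ s)"
    and "(\<Sum>k. 1 / real (n + k + 2) ^ s) \<le> 1 / real (Suc n)"
proof -
  let ?g = "\<lambda>k. 1 / real (n + k + 1) - 1 / real (n + Suc k + 1)"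
  have "(\<lambda>k. 1 / real (n + k + 1)) \<longlonglongrightarrow> 0"
    using LIMSEQ_ignore_initial_segment[OF lim_1_over_n, of "n + 1"]
    by (simp add: algebra_simps)
  from telescope_sums'[OF this] have g: "?g sums (1 / real (Suc n))"
    by simp
  have le: "1 / real (n + k + 2) ^ s \<le> ?g k" for k
  proof -
    have "1 / real (n + k + 2) ^ s \<le> 1 / real (n + k + 2) ^ 2"
      using assms by (intro divide_left_mono power_increasing) auto
    also have "\<dots> \<le> 1 / (real (n + k + 1) * real (n + k + 2))"
      unfolding power2_eq_square by (intro divide_left_mono mult_right_mono) auto
    also have "\<dots> = ?g k"
      by (simp add: field_simps)
    finally show ?thesis .
  qed
  show *: "summable (\<lambda>k. 1 / real (n + k + 2) ^ s)"
    by (rule summable_comparison_test'[OF sums_summable[OF g], of 0]) (use le in simp)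
  show "(\<Sum>k. 1 / real (n + k + 2) ^ s) \<le> 1 / real (Suc n)"
    using suminf_le[OF le * sums_summable[OF g]] sums_unique[OF g] by simp
qed

lemma sums_zeta_diff:
  assumes "s \<ge> 2"
  shows "(\<lambda>k. 1 / real (n + k + 2) ^ s) sums (zeta s - zeta_partial (Suc n) s)"
proof -
  \<comment> \<open>The tail with \<open>n = 0\<close> lacks only the first term of the zeta
    series.\<close>
  have "summable (\<lambda>k. 1 / real (Suc (k + 1)) ^ s)"
    using summable_tail(1)[OF assms, of 0] by (simp add: add_ac)
  then have "summable (\<lambda>k. 1 / real (Suc k) ^ s)"
    by (subst (asm) summable_iff_shift)
  from suminf_split_initial_segment[OF this, of "Suc n"]
  have "zeta s = (\<Sum>k. 1 / real (n + k + 2) ^ s) + zeta_partial (Suc n) s"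
    by (simp add: zeta_def zeta_partial_def sum.atLeast1_atMost_eq add_ac
        del: sum.lessThan_Suc sum.cl_ivl_Suc)
  then show ?thesis
    using summable_sums[OF summable_tail(1)[OF assms, of n]] by simp
qed

lemma sums_mzv_1:
  assumes "s \<ge> 2"
  shows "(\<lambda>n. (zeta s - zeta_partial (Suc n) s) / real (Suc n)) sums mzv [s, 1]"
proof -
  \<comment> \<open>The free pair (n, k) encodes n_2 = n + 1 and n_1 = n_2 + k + 1, so the
    constraint n_1 > n_2 \<ge> 1 disappears and the index set becomes a full product.\<close>
  define f :: "nat \<times> nat \<Rightarrow> real"
    where "f = (\<lambda>(n, k). 1 / real (n + k + 2) ^ s / real (Suc n))"
  define r where "r n = (zeta s - zeta_partial (Suc n) s) / real (Suc n)" for n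
  have inner: "((\<lambda>k. f (n, k)) has_sum r n) UNIV" for n
    unfolding f_def r_def prod.case
    by (intro sums_nonneg_imp_has_sum sums_divide sums_zeta_diff assms) auto
  have r_nonneg: "r n \<ge> 0" for n
    by (rule has_sum_nonneg[OF inner]) (auto simp: f_def)
  \<comment> \<open>The tail bound supplies one factor 1/(n+2), the denominator in \<open>r\<close>
    the other. The shift to \<open>Suc n\<close> makes the majorant an instance of
    \<open>summable_tail\<close>.\<close>
  have r_le: "r (Suc n) \<le> 1 / real (0 + n + 2) ^ 2" for n
    using summable_tail(2)[OF assms, of "Suc n"] sums_unique[OF sums_zeta_diff[OF assms, of "Suc n"]]
    by (simp add: r_def power2_eq_square divide_simps del: of_nat_Suc of_nat_add)
  have "summable (\<lambda>n. r (Suc n))"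
    by (rule summable_comparison_test'[OF summable_tail(1)[of 2 0], of 0]) (use r_le r_nonneg in auto)
  then have "summable r"
    by (subst (asm) summable_Suc_iff)
  then have r: "(r has_sum suminf r) UNIV"
    using r_nonneg by (intro sums_nonneg_imp_has_sum summable_sums)
  \<comment> \<open>Tonelli: as \<open>f\<close> is nonnegative, summable row sums give summability
    on the product.\<close>
  have f: "(f has_sum suminf r) (UNIV \<times> UNIV)"
  proof (rule has_sum_SigmaI)
    show "f summable_on UNIV \<times> UNIV"
      by (rule summable_on_SigmaI[OF _ has_sum_imp_summable[OF r]])
        (rule inner, simp add: f_def)
  qed (rule inner r)+
  \<comment> \<open>The truncated subtractions in \<open>i\<close> are exact because n_1 > n_2 \<ge>
    1.\<close>
  have "(f has_sum suminf r) (UNIV \<times> UNIV) \<longleftrightarrow>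
    ((\<lambda>ns. \<Prod>i<length [s, 1]. 1 / real (ns ! i) ^ ([s, 1] ! i)) has_sum suminf r)
      {ns :: nat list. length ns = length [s, 1] \<and> sorted_wrt (>) ns \<and> (\<forall>n\<in>set ns. n \<ge> 1)}"
    by (rule has_sum_reindex_bij_witness[where
          i = "\<lambda>ns. (ns ! 1 - 1, ns ! 0 - ns ! 1 - 1)" and
          j = "\<lambda>(n, k). [n + k + 2, Suc n]"])
      (auto simp: f_def length_Suc_conv lessThan_Suc numeral_2_eq_2)
  with f have "mzv [s, 1] = suminf r"
    unfolding mzv_def by (simp only: infsumI)
  with \<open>summable r\<close> show ?thesis
    by (simp add: r_def[abs_def] summable_sums)
qed

theorem theorem3p1:
  fixes m p :: nat
  assumes "m \<ge> 2" and "p \<ge> 2"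
  shows "(\<lambda>n. (zeta m * zeta_partial (Suc n) p - zeta p * zeta_partial (Suc n) m) / real (Suc n))
           sums (zeta p * mzv [m, 1] - zeta m * mzv [p, 1])"
proof -
  \<comment> \<open>Inserting \<open>zeta p * zeta m\<close> twice with opposite signs makes both
    series converge separately; the sums of \<open>zeta_partial (Suc n) p / real (Suc n)\<close>
    alone diverge.\<close>
  have "(\<lambda>n. zeta p * ((zeta m - zeta_partial (Suc n) m) / real (Suc n)) -
             zeta m * ((zeta p - zeta_partial (Suc n) p) / real (Suc n)))
           sums (zeta p * mzv [m, 1] - zeta m * mzv [p, 1])"
    using assms by (intro sums_diff sums_mult sums_mzv_1)
  then show ?thesis
    by (simp add: algebra_simps flip: diff_divide_distrib)
qed

end
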